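(* Let $f(z)=z+\sum_{n=2}^{\infty}a_nz^n$ be in the class $\mathcal{TR}$ of typically real functions and let $z\in\mathbb{D}$. Then $$|z|+\sum_{n=2}^{\infty}|a_nz^n|\le d(0,\partial f(\mathbb{D}))$$ for $|z|\le 3-2\sqrt2$. The result is sharp, i.e. $3-2\sqrt2$ cannot be replaced by any larger number for which the inequality holds for all $f\in\mathcal{TR}$.
   Context: $\mathbb{D}=\{z\in\mathbb{C}:|z|<1\}$. $\mathcal{TR}$ is the class of typically real functions: analytic functions $f(z)=z+\sum_{n=2}^\infty a_nz^n$ on $\mathbb{D}$ with $\operatorname{sign}(\operatorname{Im}f(z))=\operatorname{sign}(\operatorname{Im}z)$ for all non-real $z\in\mathbb{D}$. $d$ is Euclidean distance, so $d(0,\partial f(\mathbb{D}))=\inf_{\xi\in\partial f(\mathbb{D})}|\xi|$, with the convention that the infimum over the empty set is $+\infty$ (relevant if $f(\mathbb{D})=\mathbb{C}$). *)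

theory Defs
  imports "HOL-Complex_Analysis.Complex_Analysis"
begin

(* f(z) = z + sum over n >= 2 of a n * z^n on the unit disc; a 0 and a 1 play no role *)
definition normalized_expansion :: "(complex \<Rightarrow> complex) \<Rightarrow> (nat \<Rightarrow> complex) \<Rightarrow> bool" where
  "normalized_expansion f a \<longleftrightarrow>
     (\<forall>z\<in>ball 0 1. (\<lambda>n. a (n + 2) * z ^ (n + 2)) sums (f z - z))"

definition typically_real :: "(complex \<Rightarrow> complex) set" where
  "typically_real =
     {f. f analytic_on ball 0 1 \<and>
         (\<exists>a. normalized_expansion f a) \<and>
         (\<forall>z\<in>ball 0 1. z \<notin> \<real> \<longrightarrow> sgn (Im (f z)) = sgn (Im z))}"

(* Taken in ennreal so that the infimum over the empty set is infinite;
   infdist and setdist return 0 there. *)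
definition dist_to_boundary :: "complex \<Rightarrow> complex set \<Rightarrow> ennreal" where
  "dist_to_boundary w S = (INF \<xi>\<in>frontier S. ennreal (dist w \<xi>))"

definition majorant_sum :: "(nat \<Rightarrow> complex) \<Rightarrow> complex \<Rightarrow> ennreal" where
  "majorant_sum a z = ennreal (norm z) + (\<Sum>n. ennreal (norm (a (n + 2) * z ^ (n + 2))))"

end

theory Submission imports Defs begin

text \<open>
  If \<open>f\<close> is typically real then \<open>p z = (1 - z\<^sup>2) * f z / z\<close> has positive real part: on the unit circle
  \<open>(1 - z\<^sup>2) / z = - 2 * \<i> * Im z\<close>. Caratheodory's coefficient bound for \<open>p\<close> yields \<open>\<bar>a n\<bar> \<le> n\<close>, so the
  majorant is at most \<open>r / (1 - r)\<^sup>2\<close>, which equals \<open>1 / 4\<close> exactly at \<open>r = 3 - 2 * sqrt 2\<close>.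

  It remains to see that \<open>f\<close> covers the disc of radius \<open>1 / 4\<close>. Real values are covered by the
  growth of \<open>f\<close> on the axis. If \<open>f\<close> omits \<open>w\<close> with \<open>Im w > 0\<close>, it omits \<open>cnj w\<close> as well, and a suitable
  multiple \<open>h\<close> of \<open>log ((f - w) / (f - cnj w))\<close>, normalized to vanish at \<open>0\<close>, is again typically real.
  On the axis \<open>h\<close> is a multiple of the variation of \<open>Arg (w - f x)\<close>, so with \<open>\<theta> = Arg w\<close> and
  \<open>M = \<bar>w\<bar> / sin \<theta>\<close> it lies between \<open>- M * \<theta>\<close> and \<open>M * (pi - \<theta>)\<close>. On the other hand the even part of \<open>1 / p\<close>
  bounds \<open>1 / h r - 1 / h (- r)\<close> by \<open>2 * (r + 1 / r)\<close>. Letting \<open>r\<close> tend to \<open>1\<close> gives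
  \<open>4 * \<bar>w\<bar> \<ge> pi * sin \<theta> / (\<theta> * (pi - \<theta>)) \<ge> 1\<close>. The Koebe function shows sharpness.
\<close>

subsection \<open>Functions with positive real part\<close>

text \<open>At a zero of \<open>Re p\<close> the modulus of \<open>exp (- p)\<close>, which is
  \<open>exp (- Re p)\<close>, attains its upper bound 1. The maximum principle then makes
  \<open>exp (- p)\<close> constant, against its modulus \<open>exp (- 1)\<close> at the
  origin.\<close>

lemma Re_pos_of_nonneg:
  assumes holo: "p holomorphic_on ball 0 1" and nonneg: "\<And>z. z \<in> ball 0 1 \<Longrightarrow> 0 \<le> Re (p z)"
    and p0: "p 0 = 1" and z: "z \<in> ball 0 1"
  shows "0 < Re (p z)"
proof (rule ccontr)
  assume "\<not> 0 < Re (p z)"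
  then have Re_z: "Re (p z) = 0"
    using nonneg[OF z] by simp
  have "(\<lambda>w. exp (- p w)) constant_on ball 0 1"
    by (rule maximum_modulus_principle[where U = "ball 0 1" and \<xi> = z])
      (use holo z nonneg Re_z in \<open>auto intro!: holomorphic_intros\<close>)
  then have "exp (- p z) = exp (- p 0)"
    using z unfolding constant_on_def by (metis centre_in_ball zero_less_one)
  then have "norm (exp (- p z)) = norm (exp (- p 0))"
    by simp
  then show False
    using Re_z p0 by simp
qed

text \<open>The Cayley transform \<open>\<omega>\<close> of \<open>p\<close> maps the disc into
  itself and fixes 0. Its derivative there is half of \<open>deriv p 0\<close>, so the Schwarz lemma
  applies.\<close>

lemma deriv_0_le_2_of_Re_pos:
  assumes holo: "p holomorphic_on ball 0 1" and pos: "\<And>z. z \<in> ball 0 1 \<Longrightarrow> 0 < Re (p z)"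
    and p0: "p 0 = 1"
  shows "norm (deriv p 0) \<le> 2"
proof -
  define \<omega> where "\<omega> z = (p z - 1) / (p z + 1)" for z
  have nz: "p z + 1 \<noteq> 0" if "z \<in> ball 0 1" for z
    using pos[OF that] by (auto simp: complex_eq_iff)
  have lt: "norm (\<omega> z) < 1" if "norm z < 1" for z
  proof -
    have z: "z \<in> ball 0 1"
      using that by simp
    have "(norm (p z - 1))\<^sup>2 < (norm (p z + 1))\<^sup>2"
      using pos[OF z] unfolding cmod_power2 by (simp add: power2_eq_square algebra_simps)
    then have "norm (p z - 1) < norm (p z + 1)"
      by (rule power2_less_imp_less) simp
    then show ?thesis
      using nz[OF z] by (simp add: \<omega>_def norm_divide)
  qed
  have d: "(p has_field_derivative deriv p 0) (at 0)"
    by (rule holomorphic_derivI[OF holo open_ball]) simp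
  have "(\<omega> has_field_derivative deriv p 0 / 2) (at 0)"
    unfolding \<omega>_def
    by (rule derivative_eq_intros d refl | use p0 in simp)+
  then have "deriv \<omega> 0 = deriv p 0 / 2"
    by (rule DERIV_imp_deriv)
  moreover have "norm (deriv \<omega> 0) \<le> 1"
  proof (rule Schwarz_Lemma(2)[where \<xi> = 0])
    show "\<omega> holomorphic_on ball 0 1"
      unfolding \<omega>_def using nz by (intro holomorphic_intros holo) auto
  qed (use lt p0 in \<open>auto simp: \<omega>_def\<close>)
  ultimately have "norm (deriv p 0 / 2) \<le> 1"
    by metis
  then show ?thesis
    by (simp add: norm_divide)
qed

lemma sum_power_root_unity:
  fixes n m :: nat
  assumes "n > 0"
  defines "\<zeta> \<equiv> cis (2 * pi / n)"
  shows "(\<Sum>j<n. (\<zeta> ^ j) ^ m) = (if n dvd m then of_nat n else 0)"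
proof -
  have eq: "(\<Sum>j<n. (\<zeta> ^ j) ^ m) = (\<Sum>j<n. (\<zeta> ^ m) ^ j)"
    by (simp add: mult.commute flip: power_mult)
  have "\<zeta> ^ m = exp (2 * of_real pi * \<i> * of_nat m / of_nat n)"
    by (simp add: \<zeta>_def cis_conv_exp mult_ac flip: exp_of_nat_mult)
  then have one: "\<zeta> ^ m = 1 \<longleftrightarrow> n dvd m"
    using complex_root_unity_eq_1[of n m] assms by simp
  have "\<zeta> ^ n = 1"
    unfolding \<zeta>_def Complex.DeMoivre using assms(1) by simp
  then have "(\<zeta> ^ m) ^ n = 1"
    by (metis mult.commute power_mult power_one)
  then show ?thesis
    using one unfolding eq by (auto simp: geometric_sum)
qed

text \<open>Averaging \<open>p\<close> over the rotations by \<open>n\<close>-th roots of unity keeps only the terms whose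
  exponent is divisible by \<open>n\<close>; as a function of \<open>z ^ n\<close> the average still has positive real part,
  and its first coefficient is \<open>c n\<close>.\<close>

lemma Caratheodory_coeff_bound:
  assumes sums: "\<And>z. z \<in> ball 0 1 \<Longrightarrow> (\<lambda>k. c k * z ^ k) sums p z"
    and pos: "\<And>z. z \<in> ball 0 1 \<Longrightarrow> 0 < Re (p z)" and p0: "p 0 = 1" and n: "n > 0"
  shows "norm (c n) \<le> 2"
proof -
  define \<zeta> where "\<zeta> = cis (2 * pi / n)"
  define s where "s w = (\<Sum>k. c (n * k) * w ^ k)" for w
  have norm_\<zeta>: "norm \<zeta> = 1"
    by (simp add: \<zeta>_def)
  have ex: "(\<lambda>k. c (n * k) * w ^ k) sums s w \<and> 0 < Re (s w)" if w: "w \<in> ball 0 1" for w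
  proof -
    \<comment> \<open>Every point of the disc is an n-th power, so \<open>s w\<close> can be
      computed as the average of \<open>p\<close> over the n-th roots of \<open>w\<close>.\<close>
    obtain z where z: "w = z ^ n"
      using n by (metis exists_complex_root neq0_conv)
    have "norm z < 1"
    proof (rule ccontr)
      assume "\<not> norm z < 1"
      then have "1 \<le> norm z ^ n"
        by (simp add: one_le_power)
      then show False
        using w z by (simp add: norm_power)
    qed
    then have in_ball: "\<zeta> ^ j * z \<in> ball 0 1" for j
      by (simp add: norm_mult norm_power norm_\<zeta>)
    have "(\<lambda>m. (\<Sum>j<n. c m * (\<zeta> ^ j * z) ^ m) / of_nat n) sums ((\<Sum>j<n. p (\<zeta> ^ j * z)) / of_nat n)"
      using sums[OF in_ball] by (intro sums_divide sums_sum)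
    moreover have "(\<Sum>j<n. c m * (\<zeta> ^ j * z) ^ m) / of_nat n = (if n dvd m then c m * z ^ m else 0)" for m
    proof -
      have "(\<Sum>j<n. c m * (\<zeta> ^ j * z) ^ m) = c m * z ^ m * (\<Sum>j<n. (\<zeta> ^ j) ^ m)"
        by (simp add: power_mult_distrib sum_distrib_left mult_ac)
      then show ?thesis
        using n sum_power_root_unity[of n m] by (simp add: \<zeta>_def)
    qed
    ultimately have "(\<lambda>m. if n dvd m then c m * z ^ m else 0) sums ((\<Sum>j<n. p (\<zeta> ^ j * z)) / of_nat n)"
      by simp
    then have "(\<lambda>k. if n dvd n * k then c (n * k) * z ^ (n * k) else 0) sums
        ((\<Sum>j<n. p (\<zeta> ^ j * z)) / of_nat n)"
      by (subst sums_mono_reindex[where g = "\<lambda>k. n * k"]) (use n in \<open>auto simp: strict_mono_def elim: dvdE\<close>)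
    then have S: "(\<lambda>k. c (n * k) * w ^ k) sums ((\<Sum>j<n. p (\<zeta> ^ j * z)) / of_nat n)"
      by (simp add: z power_mult)
    moreover have "0 < Re ((\<Sum>j<n. p (\<zeta> ^ j * z)) / of_nat n)"
      using n pos[OF in_ball] by (auto intro!: sum_pos divide_pos_pos)
    ultimately show ?thesis
      unfolding s_def by (metis sums_unique)
  qed
  have c0: "c 0 = 1"
    using sums[of 0] p0 sums_unique2[of "\<lambda>k. c k * 0 ^ k" "p 0" "c 0"] powser_sums_zero[of c] by simp
  have s0: "s 0 = 1"
    unfolding s_def using c0 powser_zero[of "\<lambda>k. c (n * k)"] by simp
  have holo: "s holomorphic_on ball 0 1"
    by (rule power_series_holomorphic[where a = "\<lambda>k. c (n * k)"]) (use ex in simp)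
  \<comment> \<open>At 0 only the constant term of the differentiated series survives, namely
    \<open>1 * c (n * 1)\<close>.\<close>
  have "(s has_field_derivative (\<Sum>k. diffs (\<lambda>k. c (n * k)) k * 0 ^ k)) (at 0)"
    unfolding s_def
    by (rule termdiffs_strong[where K = "1/2"]) (use ex[of "1/2"] in \<open>auto simp: sums_iff\<close>)
  then have "deriv s 0 = c n"
    unfolding powser_zero by (simp add: diffs_def DERIV_imp_deriv)
  then show ?thesis
    using deriv_0_le_2_of_Re_pos[OF holo _ s0] ex by metis
qed

text \<open>Both bounds sum the coefficient estimates \<open>c 0 = 1\<close> and
  \<open>norm (c n) \<le> 2\<close> termwise; in \<open>p z + p (- z)\<close> the odd terms
  cancel.\<close>

lemma Caratheodory_growth:
  assumes holo: "p holomorphic_on ball 0 1" and pos: "\<And>z. z \<in> ball 0 1 \<Longrightarrow> 0 < Re (p z)"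
    and p0: "p 0 = 1" and z: "z \<in> ball 0 1"
  shows "norm (p z) \<le> (1 + norm z) / (1 - norm z)"
    and "norm (p z + p (- z)) \<le> 2 * (1 + (norm z)\<^sup>2) / (1 - (norm z)\<^sup>2)"
proof -
  define c where "c n = (deriv ^^ n) p 0 / fact n" for n
  define r where "r = norm z"
  have r: "0 \<le> r" "r < 1"
    using z by (auto simp: r_def)
  have sums: "(\<lambda>n. c n * w ^ n) sums p w" if "w \<in> ball 0 1" for w
    using holomorphic_power_series[OF holo that] by (simp add: c_def)
  have c0: "c 0 = 1"
    using p0 by (simp add: c_def)
  have c: "norm (c n) \<le> 2" if "n > 0" for n
    by (rule Caratheodory_coeff_bound[OF sums pos p0 that])
  have delta: "(\<lambda>n. if n = 0 then a else 0) sums a" for a :: real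
    using sums_single[of 0 "\<lambda>_. a"] by simp
  have geo: "(\<lambda>n. x ^ n) sums (1 / (1 - x))" if "\<bar>x\<bar> < 1" for x :: real
    using geometric_sums[of x] that by simp
  show "norm (p z) \<le> (1 + norm z) / (1 - norm z)"
  proof -
    have S: "(\<lambda>n. 2 * r ^ n - (if n = 0 then 1 else 0)) sums (2 * (1 / (1 - r)) - 1)"
      using r by (intro sums_diff sums_mult delta geo) auto
    have "norm (\<Sum>n. c n * z ^ n) \<le> (\<Sum>n. 2 * r ^ n - (if n = 0 then 1 else 0))"
      using c c0 r
      by (intro norm_suminf_le sums_summable[OF S])
        (auto simp: norm_mult norm_power r_def intro!: mult_right_mono)
    moreover have "2 * (1 / (1 - r)) - 1 = (1 + r) / (1 - r)"
      using r by (simp add: field_simps)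
    ultimately show ?thesis
      using sums_unique[OF S] sums_unique[OF sums[OF z]] by (simp add: r_def)
  qed
  show "norm (p z + p (- z)) \<le> 2 * (1 + (norm z)\<^sup>2) / (1 - (norm z)\<^sup>2)"
  proof -
    \<comment> \<open>This majorant is 2 at \<open>n = 0\<close>, 0 at odd \<open>n\<close>, and
      \<open>4 * r ^ n\<close> at the remaining even \<open>n\<close>.\<close>
    have S: "(\<lambda>n. 2 * (r ^ n + (- r) ^ n) - (if n = 0 then 2 else 0)) sums
        (2 * (1 / (1 - r) + 1 / (1 - - r)) - 2)"
      using r by (intro sums_diff sums_mult sums_add delta geo) auto
    have "(\<lambda>n. c n * z ^ n + c n * (- z) ^ n) sums (p z + p (- z))"
      using z by (intro sums_add sums) auto
    moreover have "norm (\<Sum>n. c n * z ^ n + c n * (- z) ^ n)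
        \<le> (\<Sum>n. 2 * (r ^ n + (- r) ^ n) - (if n = 0 then 2 else 0))"
    proof (intro norm_suminf_le sums_summable[OF S])
      fix n
      show "norm (c n * z ^ n + c n * (- z) ^ n) \<le> 2 * (r ^ n + (- r) ^ n) - (if n = 0 then 2 else 0)"
      proof (cases "n = 0 \<or> odd n")
        case False
        then have "norm (c n * z ^ n + c n * (- z) ^ n) = norm (c n) * (2 * r ^ n)"
          by (simp add: norm_mult norm_power r_def flip: mult_2)
        also have "\<dots> \<le> 2 * (2 * r ^ n)"
          using False c[of n] r by (intro mult_right_mono) auto
        finally show ?thesis
          using False by simp
      qed (auto simp: c0)
    qed
    moreover have "2 * (1 / (1 - r) + 1 / (1 - - r)) - 2 = 2 * (1 + r\<^sup>2) / (1 - r\<^sup>2)"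
    proof -
      have "1 - r\<^sup>2 = (1 - r) * (1 + r)"
        by (simp add: power2_eq_square algebra_simps)
      then show ?thesis
        using r by (simp add: divide_simps)
    qed
    ultimately show ?thesis
      using sums_unique[OF S] by (simp add: r_def sums_iff)
  qed
qed

subsection \<open>Typically real functions\<close>

text \<open>As \<open>f\<close> need not extend to the unit circle, the sign of the real part is
  read off there for a dilation, carried inside by the maximum principle, and kept in the limit
  \<open>r \<rightarrow> 1\<close>.\<close>

lemma typically_real_obtains_Caratheodory:
  assumes holo: "f holomorphic_on ball 0 1" and f0: "f 0 = 0" and f'0: "deriv f 0 = 1"
    and Im_f: "\<And>z. z \<in> ball 0 1 \<Longrightarrow> 0 \<le> Im z * Im (f z)"
  obtains p where "p holomorphic_on ball 0 1" "\<And>z. z \<in> ball 0 1 \<Longrightarrow> 0 < Re (p z)" "p 0 = 1"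
    "\<And>z. z \<in> ball 0 1 \<Longrightarrow> z * p z = (1 - z\<^sup>2) * f z"
proof -
  define g where "g z = (if z = 0 then 1 else f z / z)" for z
  define p where "p z = (1 - z\<^sup>2) * g z" for z
  have holo_g: "g holomorphic_on ball 0 1"
    by (rule holomorphic_transform[OF pole_lemma_open[OF holo open_ball, of 0]])
      (simp add: f0 f'0 g_def)
  then have holo_p: "p holomorphic_on ball 0 1"
    unfolding p_def by (intro holomorphic_intros)
  \<comment> \<open>Only \<open>g\<close> is dilated. The factor \<open>1 - z\<^sup>2\<close> stays
    as it is, so that on the circle it is still \<open>w * (cnj w - w)\<close>.\<close>
  have dilated: "0 \<le> Re ((1 - z\<^sup>2) * g (of_real r * z))" if r: "0 < r" "r < 1" and z: "norm z \<le> 1" for r z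
  proof -
    have in_ball: "of_real r * w \<in> ball 0 1" if "norm w \<le> 1" for w :: complex
      using that r by (simp add: norm_mult) (smt (verit) mult_left_le)
    have "(g \<circ> (\<lambda>w. of_real r * w)) holomorphic_on cball 0 1"
      by (rule holomorphic_on_compose_gen[OF _ holo_g]) (use in_ball in \<open>auto intro!: holomorphic_intros\<close>)
    then have holo_r: "(\<lambda>w. - ((1 - w\<^sup>2) * g (of_real r * w))) holomorphic_on cball 0 1"
      unfolding o_def by (intro holomorphic_intros)
    have "Re (- ((1 - z\<^sup>2) * g (of_real r * z))) \<le> 0"
    proof (rule maximum_real_frontier[where S = "cball 0 1" and B = 0 and \<xi> = z
          and f = "\<lambda>w. - ((1 - w\<^sup>2) * g (of_real r * w))"])
      fix w :: complex assume "w \<in> frontier (cball 0 1)"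
      then have w: "norm w = 1"
        by simp
      then have "w \<noteq> 0" and "w * cnj w = 1"
        by (auto simp: complex_mult_cnj cmod_def)
      then have "(1 - w\<^sup>2) * g (of_real r * w) = (cnj w - w) * f (of_real r * w) / of_real r"
        using r by (simp add: g_def field_simps power2_eq_square)
      also have "cnj w - w = - 2 * \<i> * of_real (Im w)"
        by (simp add: complex_eq_iff)
      finally have eq: "(1 - w\<^sup>2) * g (of_real r * w) = - 2 * \<i> * of_real (Im w) * f (of_real r * w) / of_real r" .
      have "Re ((1 - w\<^sup>2) * g (of_real r * w)) = 2 * (Im (of_real r * w) * Im (f (of_real r * w))) / r\<^sup>2"
        unfolding eq using r by (simp add: field_simps power2_eq_square)
      then show "Re (- ((1 - w\<^sup>2) * g (of_real r * w))) \<le> 0"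
        using Im_f[OF in_ball[of w]] w by simp
    qed (use z holo_r in \<open>auto intro: holomorphic_on_subset holomorphic_on_imp_continuous_on\<close>)
    then show ?thesis
      by simp
  qed
  have nonneg: "0 \<le> Re (p z)" if z: "z \<in> ball 0 1" for z
  proof (rule tendsto_lowerbound)
    have "isCont g z"
      using holomorphic_on_imp_continuous_on[OF holo_g] z by (simp add: continuous_on_eq_continuous_at)
    then show "((\<lambda>r. Re ((1 - z\<^sup>2) * g (of_real r * z))) \<longlongrightarrow> Re (p z)) (at_left 1)"
      unfolding p_def
      by (intro tendsto_intros isCont_tendsto_compose[of z g]) (auto intro!: tendsto_eq_intros)
    have "\<forall>\<^sub>F r :: real in at_left 1. r \<in> {0<..<1}"
      by (rule eventually_at_left_real) simp
    then show "\<forall>\<^sub>F r in at_left 1. 0 \<le> Re ((1 - z\<^sup>2) * g (of_real r * z))"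
      by eventually_elim (use dilated z in auto)
  qed simp
  have p0: "p 0 = 1"
    by (simp add: p_def g_def)
  show ?thesis
  proof
    show "0 < Re (p z)" if "z \<in> ball 0 1" for z
      by (rule Re_pos_of_nonneg[OF holo_p nonneg p0 that])
    show "z * p z = (1 - z\<^sup>2) * f z" if "z \<in> ball 0 1" for z
      by (simp add: p_def g_def f0)
  qed fact+
qed

text \<open>Comparing coefficients in \<open>p = (1 - z\<^sup>2) * g\<close> gives
  \<open>c n = b n - b (n - 2)\<close>, and \<open>norm (c n) \<le> 2\<close> allows an induction in
  steps of two. As \<open>b\<close> expands \<open>f z / z\<close>, its index is one below that of
  the coefficient of \<open>f\<close>.\<close>

lemma typically_real_coeff_bound:
  assumes holo: "f holomorphic_on ball 0 1" and f'0: "deriv f 0 = 1"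
    and Im_f: "\<And>z. z \<in> ball 0 1 \<Longrightarrow> 0 \<le> Im z * Im (f z)"
    and f: "\<And>z. f z = z * g z"
    and sums: "\<And>z. z \<in> ball 0 1 \<Longrightarrow> (\<lambda>n. b n * z ^ n) sums g z" and b0: "b 0 = 1"
  shows "norm (b n) \<le> n + 1"
proof -
  have g0: "g 0 = 1"
    using sums_unique2[OF sums[of 0] powser_sums_zero] b0 by simp
  obtain p where p: "p holomorphic_on ball 0 1" "\<And>z. z \<in> ball 0 1 \<Longrightarrow> 0 < Re (p z)" "p 0 = 1"
    and p_eq: "\<And>z. z \<in> ball 0 1 \<Longrightarrow> z * p z = (1 - z\<^sup>2) * f z"
    using typically_real_obtains_Caratheodory[OF holo _ f'0 Im_f] f by auto
  have p_g: "p z = g z - z\<^sup>2 * g z" if "z \<in> ball 0 1" for z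
  proof (cases "z = 0")
    case False
    have "z * p z = z * (g z - z\<^sup>2 * g z)"
      using p_eq[OF that] f[of z] by (simp add: algebra_simps)
    then show ?thesis
      using False by simp
  qed (simp add: p g0)
  define c where "c n = b n - (if n < 2 then 0 else b (n - 2))" for n
  have sums_c: "(\<lambda>n. c n * z ^ n) sums p z" if z: "z \<in> ball 0 1" for z
  proof -
    have "(\<lambda>n. z\<^sup>2 * (b n * z ^ n)) sums (z\<^sup>2 * g z)"
      by (intro sums_mult sums z)
    then have "(\<lambda>n. if n + 2 < 2 then 0 else b (n + 2 - 2) * z ^ (n + 2)) sums (z\<^sup>2 * g z)"
      by (simp add: power2_eq_square mult_ac)
    then have "(\<lambda>n. if n < 2 then 0 else b (n - 2) * z ^ n) sums
        (z\<^sup>2 * g z + (\<Sum>n<2. if n < 2 then 0 else b (n - 2) * z ^ n))"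
      by (rule sums_iff_shift[THEN iffD1])
    then have "(\<lambda>n. if n < 2 then 0 else b (n - 2) * z ^ n) sums (z\<^sup>2 * g z)"
      by simp
    from sums_diff[OF sums[OF z] this] show ?thesis
      unfolding p_g[OF z] by (rule sums_cong[THEN iffD1, rotated]) (auto simp: c_def algebra_simps)
  qed
  have c: "norm (c n) \<le> 2" if "n > 0" for n
    by (rule Caratheodory_coeff_bound[OF sums_c p(2,3) that])
  show ?thesis
  proof (induction n rule: less_induct)
    case (less n)
    consider "n = 0" | "n = 1" | "n \<ge> 2"
      by linarith
    then show ?case
    proof cases
      case 2
      then show ?thesis
        using c[of 1] by (simp add: c_def)
    next
      case 3
      then have "norm (b n) \<le> norm (c n) + norm (b (n - 2))"
        using norm_triangle_ineq[of "c n" "b (n - 2)"] by (simp add: c_def)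
      also have "\<dots> \<le> 2 + (real (n - 2) + 1)"
        using 3 c[of n] less.IH[of "n - 2"] by (intro add_mono) auto
      finally show ?thesis
        using 3 by simp
    qed (use b0 in simp)
  qed
qed

section \<open>Values of typically real functions on the real axis\<close>

lemma typically_real_on_axis:
  assumes holo: "f holomorphic_on ball 0 1"
    and Im_f: "\<And>z. z \<in> ball 0 1 \<Longrightarrow> 0 \<le> Im z * Im (f z)" and x: "\<bar>x\<bar> < 1"
  shows "Im (f (of_real x)) = 0"
proof -
  have "isCont f (of_real x)"
    using holomorphic_on_imp_continuous_on[OF holo] x by (simp add: continuous_on_eq_continuous_at)
  \<comment> \<open>The sign hypothesis is vacuous on the axis itself, so \<open>f x\<close> is
    approached vertically: \<open>s = 1\<close> from above gives \<open>Im \<ge> 0\<close>,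
    \<open>s = - 1\<close> from below gives \<open>Im \<le> 0\<close>.\<close>
  then have lim: "((\<lambda>t. Im (f (of_real x + \<i> * of_real (s * t)))) \<longlongrightarrow> Im (f (of_real x))) (at_right 0)" for s
    by (intro tendsto_intros isCont_tendsto_compose[of "of_real x" f]) (auto intro!: tendsto_eq_intros)
  have "\<forall>\<^sub>F t :: real in at_right 0. t \<in> {0<..<1 - \<bar>x\<bar>}"
    using x by (intro eventually_at_right_real) simp
  then have sgn: "\<forall>\<^sub>F t in at_right 0. 0 \<le> s * Im (f (of_real x + \<i> * of_real (s * t)))"
    if "\<bar>s\<bar> = 1" for s :: real
  proof eventually_elim
    case (elim t)
    have "norm (of_real x + \<i> * of_real (s * t)) \<le> \<bar>x\<bar> + \<bar>s * t\<bar>"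
      using norm_triangle_ineq[of "of_real x" "\<i> * of_real (s * t)"] by (simp add: norm_mult)
    then have "0 \<le> (s * t) * Im (f (of_real x + \<i> * of_real (s * t)))"
      using Im_f[of "of_real x + \<i> * of_real (s * t)"] elim that by (simp add: abs_mult)
    then have "0 \<le> t * (s * Im (f (of_real x + \<i> * of_real (s * t))))"
      by (simp add: mult_ac)
    then show ?case
      using elim by (simp add: zero_le_mult_iff)
  qed
  have "0 \<le> Im (f (of_real x))"
    using tendsto_lowerbound[OF lim[of 1] _ trivial_limit_at_right_real] sgn[of 1] by simp
  moreover have "Im (f (of_real x)) \<le> 0"
    using tendsto_upperbound[OF lim[of "-1"] _ trivial_limit_at_right_real] sgn[of "-1"] by simp
  ultimately show ?thesis
    by simp
qed

text \<open>The reciprocal \<open>q = 1 / p\<close> is again normalized with positive real part, and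
  at \<open>x = r\<close> or \<open>x = - r\<close> it equals
  \<open>x / ((1 - r\<^sup>2) * f x)\<close>. Upper bounds on \<open>q\<close> thus become lower
  bounds on the modulus of \<open>f\<close>, and the bound on \<open>q r + q (- r)\<close> becomes
  one on the difference of the reciprocals of \<open>f\<close>.\<close>

lemma typically_real_axis_bounds:
  assumes holo: "f holomorphic_on ball 0 1" and f0: "f 0 = 0" and f'0: "deriv f 0 = 1"
    and Im_f: "\<And>z. z \<in> ball 0 1 \<Longrightarrow> 0 \<le> Im z * Im (f z)" and r: "0 < r" "r < 1"
  shows "r / (1 + r)\<^sup>2 \<le> Re (f (of_real r))"
    and "Re (f (- of_real r)) \<le> - (r / (1 + r)\<^sup>2)"
    and "1 / Re (f (of_real r)) - 1 / Re (f (- of_real r)) \<le> 2 * (1 + r\<^sup>2) / r"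
proof -
  obtain p where p: "p holomorphic_on ball 0 1" "\<And>z. z \<in> ball 0 1 \<Longrightarrow> 0 < Re (p z)" "p 0 = 1"
    and p_eq: "\<And>z. z \<in> ball 0 1 \<Longrightarrow> z * p z = (1 - z\<^sup>2) * f z"
    using typically_real_obtains_Caratheodory[OF holo f0 f'0 Im_f] by blast
  define q where "q z = 1 / p z" for z
  have p_nz: "p z \<noteq> 0" if "z \<in> ball 0 1" for z
    using p(2)[OF that] by auto
  have q: "q holomorphic_on ball 0 1" "q 0 = 1"
    unfolding q_def using p_nz p(1,3) by (auto intro!: holomorphic_intros)
  have Re_q: "0 < Re (q z)" if "z \<in> ball 0 1" for z
    using p(2)[OF that] p_nz[OF that] by (simp add: q_def Re_divide cmod_def divide_pos_pos sum_power2_gt_zero_iff)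
  have r2: "0 < 1 - r\<^sup>2" "1 - r\<^sup>2 = (1 - r) * (1 + r)"
    using r by (auto simp: abs_square_less_1) (simp add: power2_eq_square algebra_simps)
  have val: "f (of_real x) = of_real (Re (f (of_real x))) \<and> 0 < x * Re (f (of_real x)) \<and>
      q (of_real x) = of_real (x / ((1 - r\<^sup>2) * Re (f (of_real x))))" if x: "\<bar>x\<bar> = r" for x
  proof -
    have in_ball: "of_real x \<in> ball (0 :: complex) 1" and x2: "x\<^sup>2 = r\<^sup>2" and x0: "x \<noteq> 0"
      using x r by auto
    define y where "y = Re (f (of_real x))"
    have y: "f (of_real x) = of_real y"
      using typically_real_on_axis[OF holo Im_f, of x] x r by (simp add: y_def complex_eq_iff)
    have "of_real x * p (of_real x) = of_real ((1 - r\<^sup>2) * y)"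
      using p_eq[OF in_ball] y by (simp flip: x2)
    then have p_x: "p (of_real x) = of_real ((1 - r\<^sup>2) * y / x)"
      using x0 by (simp add: field_simps)
    then have "0 < (1 - r\<^sup>2) * y / x"
      using p(2)[OF in_ball] by (metis Re_complex_of_real)
    then have "0 < (1 - r\<^sup>2) * (y / x)"
      by simp
    then have "0 < y / x"
      by (rule zero_less_mult_pos[OF _ r2(1)])
    then have "0 < x * y"
      by (auto simp: zero_less_divide_iff zero_less_mult_iff)
    moreover have "q (of_real x) = of_real (x / ((1 - r\<^sup>2) * y))"
      by (simp add: q_def p_x)
    ultimately show ?thesis
      using y unfolding y_def by blast
  qed
  have growth: "r / (1 + r)\<^sup>2 \<le> \<bar>Re (f (of_real x))\<bar>" if x: "\<bar>x\<bar> = r" for x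
  proof -
    define y where "y = Re (f (of_real x))"
    have y: "0 < x * y" "q (of_real x) = of_real (x / ((1 - r\<^sup>2) * y))"
      using val[OF x] by (auto simp: y_def)
    have "norm (q (of_real x)) \<le> (1 + r) / (1 - r)"
      using Caratheodory_growth(1)[OF q(1) Re_q q(2), of "of_real x"] x r by simp
    moreover have "norm (q (of_real x)) = r / ((1 - r\<^sup>2) * \<bar>y\<bar>)"
      unfolding y(2) norm_of_real using x r2(1) by (simp add: abs_mult)
    ultimately have "r / ((1 - r) * (1 + r) * \<bar>y\<bar>) \<le> (1 + r) / (1 - r)"
      by (simp add: r2(2))
    moreover have "0 < \<bar>y\<bar>"
      using y(1) by auto
    ultimately have "r \<le> (1 + r) * (1 + r) * \<bar>y\<bar>"
      using r by (simp add: divide_simps split: if_splits)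
    then show ?thesis
      using r by (simp add: y_def power2_eq_square divide_simps mult_ac)
  qed
  show "r / (1 + r)\<^sup>2 \<le> Re (f (of_real r))"
    using growth[of r] val[of r] r by (simp add: zero_less_mult_iff)
  show "Re (f (- of_real r)) \<le> - (r / (1 + r)\<^sup>2)"
    using growth[of "- r"] val[of "- r"] r by (simp add: mult_less_0_iff)
  show "1 / Re (f (of_real r)) - 1 / Re (f (- of_real r)) \<le> 2 * (1 + r\<^sup>2) / r"
  proof -
    define u v where "u = Re (f (of_real r))" and "v = Re (f (- of_real r))"
    have q_r: "q (of_real r) = of_real (r / ((1 - r\<^sup>2) * u))"
      and q_mr: "q (- of_real r) = of_real (- r / ((1 - r\<^sup>2) * v))"
      using val[of r] val[of "- r"] r by (simp_all add: u_def v_def)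
    have "r / (1 - r\<^sup>2) * (1 / u - 1 / v) = r / ((1 - r\<^sup>2) * u) + - r / ((1 - r\<^sup>2) * v)"
      by (simp add: right_diff_distrib)
    also have "\<dots> \<le> norm (q (of_real r) + q (- of_real r))"
      unfolding q_r q_mr of_real_add[symmetric] norm_of_real by simp
    also have "\<dots> \<le> 2 * (1 + r\<^sup>2) / (1 - r\<^sup>2)"
      using Caratheodory_growth(2)[OF q(1) Re_q q(2), of "of_real r"] r by simp
    finally have "r * (1 / u - 1 / v) \<le> 2 * (1 + r\<^sup>2)"
      using r2(1) by (simp add: divide_le_cancel)
    then show ?thesis
      using r unfolding u_def v_def by (simp add: pos_le_divide_eq mult.commute)
  qed
qed

section \<open>Omitted values and the covered disc of radius 1/4\<close>

lemma quadratic_le_pi_sin: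
  assumes "0 \<le> x" "x \<le> pi"
  shows "x * (pi - x) \<le> pi * sin x"
proof -
  \<comment> \<open>Inserting this Taylor bound reduces the claim to \<open>pi * x \<le> 6\<close>.
    For \<open>x \<le> pi / 2\<close> that follows from \<open>pi\<^sup>2 \<le> 12\<close>; the
    other half is the reflection \<open>pi - x\<close>.\<close>
  have cubic: "x - x ^ 3 / 6 \<le> sin x" if "0 \<le> x" for x :: real
  proof -
    have "\<bar>sin x - x\<bar> \<le> x ^ 3 / 6"
      using Maclaurin_sin_bound[of x 3] that
      by (simp add: sin_coeff_def numeral_3_eq_3 fact_numeral)
    then show ?thesis
      by linarith
  qed
  have "pi\<^sup>2 \<le> 12"
  proof (rule ccontr)
    \<comment> \<open>Since \<open>sin t = 1 / 2\<close>, the cubic bound sharpens the crude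
      \<open>t < 2 / 3\<close> to \<open>t \<le> 27 / 50\<close>, whose square is below
      \<open>1 / 3\<close>.\<close>
    define t where "t = pi / 6"
    assume "\<not> pi\<^sup>2 \<le> 12"
    then have t2: "1 / 3 < t\<^sup>2"
      by (simp add: t_def power2_eq_square)
    have t: "0 < t" "t < 2 / 3"
      using pi_gt_zero pi_less_4 by (auto simp: t_def)
    have "t\<^sup>2 < (2 / 3)\<^sup>2"
      using t by (intro power_strict_mono) auto
    then have "t * (1 - (2/3)\<^sup>2 / 6) \<le> t * (1 - t\<^sup>2 / 6)"
      using t by (intro mult_left_mono) auto
    also have "\<dots> \<le> 1 / 2"
      using cubic[of t] t sin_30 by (simp add: t_def power3_eq_cube power2_eq_square algebra_simps)
    finally have "t \<le> 27 / 50"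
      by (simp add: power2_eq_square)
    then have "t\<^sup>2 \<le> (27 / 50)\<^sup>2"
      using t by (intro power_mono) auto
    then show False
      using t2 by (simp add: power2_eq_square)
  qed
  have half: "x * (pi - x) \<le> pi * sin x" if x: "0 \<le> x" "x \<le> pi / 2" for x
  proof -
    have "pi * x \<le> pi\<^sup>2 / 2"
      using mult_left_mono[OF x(2), of pi] by (simp add: power2_eq_square)
    then have "0 \<le> 1 - pi * x / 6"
      using \<open>pi\<^sup>2 \<le> 12\<close> by linarith
    then have "0 \<le> x\<^sup>2 * (1 - pi * x / 6)"
      by simp
    then have "x * (pi - x) \<le> pi * (x - x ^ 3 / 6)"
      by (simp add: power2_eq_square power3_eq_cube algebra_simps)
    also have "\<dots> \<le> pi * sin x"
      using cubic x by (intro mult_left_mono) auto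
    finally show ?thesis .
  qed
  show ?thesis
  proof (cases "x \<le> pi / 2")
    case False
    then show ?thesis
      using half[of "pi - x"] assms by (simp add: mult.commute)
  qed (use half assms in simp)
qed

text \<open>Where \<open>f\<close> is real, \<open>a - f\<close> is non-real and avoids the branch
  cut of \<open>Ln\<close>. There \<open>g\<close> and \<open>Ln (a - f)\<close> have the same
  derivative, so they differ by a constant along the segment. The sign in \<open>a - f\<close> makes
  \<open>Ln a\<close> the initial value when \<open>f 0 = 0\<close>.\<close>

lemma exp_eq_minus_imp_log_on_axis:
  assumes f: "f holomorphic_on ball 0 1" and g: "g holomorphic_on ball 0 1"
    and exp_g: "\<And>z. z \<in> ball 0 1 \<Longrightarrow> exp (g z) = f z - a"
    and real: "\<And>x. \<bar>x\<bar> < 1 \<Longrightarrow> Im (f (of_real x)) = 0" and a: "Im a \<noteq> 0" and x: "\<bar>x\<bar> < 1"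
  shows "g (of_real x) - g 0 = Ln (a - f (of_real x)) - Ln (a - f 0)"
proof -
  define S where "S = complex_of_real ` {-1<..<1}"
  have S: "convex S" "S \<subseteq> ball 0 1"
    unfolding S_def by (auto intro!: convex_linear_image linear_of_real)
  have "\<exists>k. \<forall>z\<in>S. g z - Ln (a - f z) = k"
  proof (rule has_field_derivative_zero_constant[OF S(1)])
    fix z assume "z \<in> S"
    then have z: "z \<in> ball 0 1" and "Im (f z) = 0"
      using S(2) real by (auto simp: S_def)
    then have slit: "a - f z \<notin> \<real>\<^sub>\<le>\<^sub>0"
      using a by (auto simp: complex_nonpos_Reals_iff)
    have df: "(f has_field_derivative deriv f z) (at z)" and dg: "(g has_field_derivative deriv g z) (at z)"
      using holomorphic_derivI[OF f open_ball z] holomorphic_derivI[OF g open_ball z] by auto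
    have "((\<lambda>z. exp (g z)) has_field_derivative deriv f z) (at z)"
      by (rule has_field_derivative_transform_within_open[where S = "ball 0 1" and f = "\<lambda>z. f z - a"])
        (use z exp_g in \<open>auto intro!: derivative_eq_intros df\<close>)
    moreover have "((\<lambda>z. exp (g z)) has_field_derivative exp (g z) * deriv g z) (at z)"
      by (auto intro!: derivative_eq_intros dg)
    ultimately have "deriv f z = (f z - a) * deriv g z"
      using DERIV_unique exp_g[OF z] by metis
    then have "deriv f z = - ((a - f z) * deriv g z)"
      by (simp add: algebra_simps)
    then have "deriv g z - inverse (a - f z) * (- deriv f z) = 0"
      using slit by (cases "a = f z") auto
    moreover have "((\<lambda>z. g z - Ln (a - f z)) has_field_derivative
        deriv g z - inverse (a - f z) * (- deriv f z)) (at z)"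
      using slit by (auto intro!: derivative_eq_intros df dg simp: field_simps)
    ultimately show "((\<lambda>z. g z - Ln (a - f z)) has_field_derivative 0) (at z within S)"
      by (metis has_field_derivative_at_within)
  qed
  then obtain k where k: "\<And>z. z \<in> S \<Longrightarrow> g z - Ln (a - f z) = k"
    by blast
  have "0 \<in> S" "of_real x \<in> S"
    using x by (auto simp: S_def image_iff intro: bexI[of _ 0])
  then show ?thesis
    using k[of 0] k[of "of_real x"] by (metis (no_types, opaque_lifting) add_diff_cancel_left' add_diff_eq diff_add_cancel)
qed

lemma typically_real_omitted_nonreal:
  assumes holo: "f holomorphic_on ball 0 1" and f0: "f 0 = 0" and f'0: "deriv f 0 = 1"
    and Im_f: "\<And>z. z \<in> ball 0 1 \<Longrightarrow> 0 \<le> Im z * Im (f z)"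
    and w: "0 < Im w" and omit: "w \<notin> f ` ball 0 1" "cnj w \<notin> f ` ball 0 1"
  shows "1 / 4 \<le> norm w"
proof -
  have nz: "f z - w \<noteq> 0" "f z - cnj w \<noteq> 0" if "z \<in> ball 0 1" for z
    using omit that by (metis eq_iff_diff_eq_0 imageI)+
  have contr: "contractible (ball (0 :: complex) 1)"
    by (simp add: convex_imp_contractible)
  obtain g1 where g1: "g1 holomorphic_on ball 0 1" "\<And>z. z \<in> ball 0 1 \<Longrightarrow> f z - w = exp (g1 z)"
    by (rule contractible_imp_holomorphic_log[of "\<lambda>z. f z - w", OF _ contr])
      (use nz holo in \<open>auto intro!: holomorphic_intros\<close>)
  obtain g2 where g2: "g2 holomorphic_on ball 0 1" "\<And>z. z \<in> ball 0 1 \<Longrightarrow> f z - cnj w = exp (g2 z)"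
    by (rule contractible_imp_holomorphic_log[of "\<lambda>z. f z - cnj w", OF _ contr])
      (use nz holo in \<open>auto intro!: holomorphic_intros\<close>)
  have w_nz: "w \<noteq> 0"
    using w by auto
  \<comment> \<open>The derivative of \<open>g1 - g2\<close> at 0 is
    \<open>2 * \<i> * Im w / (norm w)\<^sup>2\<close>, and this \<open>c\<close> scales
    \<open>deriv h 0\<close> to 1. The factor \<open>\<i>\<close> turns the logarithm of the modulus
    into an imaginary part.\<close>
  define c where "c = - (norm w)\<^sup>2 / (2 * Im w)"
  define h where "h z = \<i> * of_real c * (g1 z - g2 z - (g1 0 - g2 0))" for z
  have holo_h: "h holomorphic_on ball 0 1"
    unfolding h_def by (intro holomorphic_intros g1 g2)
  have d_log: "(g has_field_derivative - 1 / a) (at 0)"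
    if g: "g holomorphic_on ball 0 1" "\<And>z. z \<in> ball 0 1 \<Longrightarrow> f z - a = exp (g z)" and a: "a \<noteq> 0" for g a
  proof -
    have df: "(f has_field_derivative 1) (at 0)" and dg: "(g has_field_derivative deriv g 0) (at 0)"
      using holomorphic_derivI[OF holo open_ball, of 0] holomorphic_derivI[OF g(1) open_ball, of 0] f'0
      by auto
    have "((\<lambda>z. exp (g z)) has_field_derivative 1) (at 0)"
      by (rule has_field_derivative_transform_within_open[where S = "ball 0 1" and f = "\<lambda>z. f z - a"])
        (use g in \<open>auto intro!: derivative_eq_intros df\<close>)
    moreover have "((\<lambda>z. exp (g z)) has_field_derivative exp (g 0) * deriv g 0) (at 0)"
      by (auto intro!: derivative_eq_intros dg)
    ultimately have "1 = exp (g 0) * deriv g 0"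
      by (rule DERIV_unique)
    moreover have "exp (g 0) = - a"
      using g(2)[of 0] f0 by simp
    ultimately have "- 1 = a * deriv g 0"
      by (metis add.inverse_inverse mult_minus_left)
    then have "deriv g 0 = - 1 / a"
      using a by (simp add: field_simps)
    then show ?thesis
      using dg by simp
  qed
  have "(h has_field_derivative \<i> * of_real c * (- 1 / w - - 1 / cnj w)) (at 0)"
    unfolding h_def
    by (auto intro!: derivative_eq_intros d_log[OF g1] d_log[OF g2] simp: w_nz)
  moreover have "\<i> * of_real c * (- 1 / w - - 1 / cnj w) = 1"
  proof -
    have "- 1 / w - - 1 / cnj w = (w - cnj w) / (w * cnj w)"
      using w_nz by (simp add: field_simps)
    also have "\<dots> = 2 * \<i> * of_real (Im w) / of_real ((norm w)\<^sup>2)"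
      by (simp add: complex_diff_cnj complex_norm_square[symmetric])
    finally show ?thesis
      using w w_nz by (simp add: c_def)
  qed
  ultimately have h'0: "deriv h 0 = 1"
    using DERIV_imp_deriv by fastforce
  have Re_log: "Re (g z) = ln (norm (f z - a))"
    if "z \<in> ball 0 1" "\<And>z. z \<in> ball 0 1 \<Longrightarrow> f z - a = exp (g z)" for g z a
    unfolding that(2)[OF that(1)] by simp
  \<comment> \<open>\<open>Im (h z)\<close> is \<open>c\<close> times the logarithm of the ratio of
    the distances from \<open>f z\<close> to \<open>w\<close> and to \<open>cnj w\<close>. The
    nearer of the two points lies on the side of \<open>f z\<close>, and \<open>c \<le> 0\<close>
    gives the right sign.\<close>
  have Im_h: "0 \<le> Im z * Im (h z)" if z: "z \<in> ball 0 1" for z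
  proof -
    have "norm (f 0 - w) = norm (f 0 - cnj w)"
      by (simp add: f0)
    then have "Im (h z) = c * (ln (norm (f z - w)) - ln (norm (f z - cnj w)))"
      using Re_log[OF z g1(2)] Re_log[OF z g2(2)] Re_log[OF _ g1(2), of 0] Re_log[OF _ g2(2), of 0]
      by (simp add: h_def)
    moreover have "Im z * (ln (norm (f z - w)) - ln (norm (f z - cnj w))) \<le> 0"
    proof -
      have pos: "0 < norm (f z - w)" "0 < norm (f z - cnj w)"
        using nz[OF z] by auto
      have sq: "(norm (f z - w))\<^sup>2 + 4 * Im w * Im (f z) = (norm (f z - cnj w))\<^sup>2"
        unfolding cmod_power2 by (simp add: power2_eq_square algebra_simps)
      consider "Im z = 0" | "0 < Im z" | "Im z < 0"
        by linarith
      then show ?thesis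
      proof cases
        case 2
        then have "0 \<le> Im (f z)"
          using Im_f[OF z] by (simp add: zero_le_mult_iff)
        then have "(norm (f z - w))\<^sup>2 \<le> (norm (f z - cnj w))\<^sup>2"
          using w by (simp flip: sq)
        then have "norm (f z - w) \<le> norm (f z - cnj w)"
          by (rule power2_le_imp_le) simp
        then show ?thesis
          using pos 2 by (intro mult_nonneg_nonpos) auto
      next
        case 3
        then have "Im (f z) \<le> 0"
          using Im_f[OF z] by (simp add: zero_le_mult_iff)
        then have "(norm (f z - cnj w))\<^sup>2 \<le> (norm (f z - w))\<^sup>2"
          using w by (simp add: mult_nonneg_nonpos flip: sq)
        then have "norm (f z - cnj w) \<le> norm (f z - w)"
          by (rule power2_le_imp_le) simp
        then show ?thesis
          using pos 3 by (intro mult_nonpos_nonneg) auto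
      qed simp
    qed
    moreover have "c \<le> 0"
      using w by (simp add: c_def divide_nonpos_pos)
    ultimately show ?thesis
      by (simp add: mult.left_commute mult_nonpos_nonpos)
  qed
  have h0: "h 0 = 0"
    by (simp add: h_def)
  define \<theta> where "\<theta> = Im (Ln w)"
  define M where "M = (norm w)\<^sup>2 / Im w"
  have \<theta>: "0 < \<theta>" "\<theta> < pi"
    using Im_Ln_pos_lt_imp[OF w] by (auto simp: \<theta>_def)
  have sin_\<theta>: "sin \<theta> = Im w / norm w"
    using sin_Arg[OF w_nz] by (simp add: \<theta>_def Arg_eq_Im_Ln w_nz)
  have M: "0 < M"
    using w w_nz by (simp add: M_def)
  have real_axis: "Im (f (of_real x)) = 0" if "\<bar>x\<bar> < 1" for x
    by (rule typically_real_on_axis[OF holo Im_f that])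
  \<comment> \<open>On the axis \<open>h x = M * (\<alpha> - \<theta>)\<close>, where the argument
    \<open>\<alpha>\<close> of \<open>w - f x\<close> stays in \<open>(0, pi)\<close> because
    \<open>w - f x\<close> keeps the imaginary part of \<open>w\<close>.\<close>
  have h_axis: "- (M * \<theta>) \<le> Re (h (of_real x)) \<and> Re (h (of_real x)) \<le> M * (pi - \<theta>)"
    if x: "\<bar>x\<bar> < 1" for x
  proof -
    define \<alpha> where "\<alpha> = Im (Ln (w - f (of_real x)))"
    have Im_pos: "0 < Im (w - f (of_real x))"
      using w real_axis[OF x] by simp
    have "cnj (f (of_real x)) = f (of_real x)"
      using real_axis[OF x] by (simp add: complex_eq_iff)
    then have cnj_log: "Ln (cnj w - f (of_real x)) = cnj (Ln (w - f (of_real x)))"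
      using Im_pos by (subst cnj_Ln) (auto simp: complex_nonpos_Reals_iff)
    have cnj_log0: "Ln (cnj w) = cnj (Ln w)"
      using w by (subst cnj_Ln) (auto simp: complex_nonpos_Reals_iff)
    have 1: "g1 (of_real x) - g1 0 = Ln (w - f (of_real x)) - Ln (w - f 0)"
      by (rule exp_eq_minus_imp_log_on_axis[OF holo g1(1)]) (use g1 real_axis w x in auto)
    have 2: "g2 (of_real x) - g2 0 = Ln (cnj w - f (of_real x)) - Ln (cnj w - f 0)"
      by (rule exp_eq_minus_imp_log_on_axis[OF holo g2(1)]) (use g2 real_axis w x in auto)
    have "g1 (of_real x) - g2 (of_real x) - (g1 0 - g2 0) = (g1 (of_real x) - g1 0) - (g2 (of_real x) - g2 0)"
      by simp
    also have "\<dots> = (Ln (w - f (of_real x)) - cnj (Ln (w - f (of_real x)))) - (Ln w - cnj (Ln w))"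
      unfolding 1 2 cnj_log f0 by (simp add: cnj_log0)
    also have "\<dots> = 2 * \<i> * of_real (\<alpha> - \<theta>)"
      by (simp add: complex_eq_iff \<alpha>_def \<theta>_def)
    finally have "Re (h (of_real x)) = - 2 * c * (\<alpha> - \<theta>)"
      by (simp add: h_def)
    also have "- 2 * c = M"
      by (simp add: c_def M_def)
    finally have "Re (h (of_real x)) = M * (\<alpha> - \<theta>)" .
    moreover have "M * (0 - \<theta>) \<le> M * (\<alpha> - \<theta>)" "M * (\<alpha> - \<theta>) \<le> M * (pi - \<theta>)"
      unfolding mult_le_cancel_left_pos[OF M] using Im_Ln_pos_lt_imp[OF Im_pos] by (simp_all add: \<alpha>_def)
    ultimately show ?thesis
      by simp
  qed
  \<comment> \<open>\<open>h\<close> satisfies the hypotheses of the axis estimate itself; its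
    values at \<open>r\<close> and \<open>- r\<close> are replaced by their extreme possible
    sizes.\<close>
  have bound: "1 / (M * (pi - \<theta>)) + 1 / (M * \<theta>) \<le> 2 * (1 + r\<^sup>2) / r" if r: "0 < r" "r < 1" for r
  proof -
    note axis = typically_real_axis_bounds[OF holo_h h0 h'0 Im_h r]
    have "0 < r / (1 + r)\<^sup>2"
      using r by simp
    then have pos: "0 < Re (h (of_real r))" "0 < - Re (h (- of_real r))"
      using axis(1,2) by auto
    have le: "Re (h (of_real r)) \<le> M * (pi - \<theta>)" "- Re (h (- of_real r)) \<le> M * \<theta>"
      using h_axis[of r] h_axis[of "- r"] r by auto
    have "1 / (M * (pi - \<theta>)) \<le> 1 / Re (h (of_real r))" "1 / (M * \<theta>) \<le> 1 / - Re (h (- of_real r))"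
      using frac_le[OF zero_le_one order_refl pos(1) le(1)] frac_le[OF zero_le_one order_refl pos(2) le(2)]
      by blast+
    then show ?thesis
      using axis(3) by simp
  qed
  have "1 / (M * (pi - \<theta>)) + 1 / (M * \<theta>) \<le> 4"
  proof (rule tendsto_lowerbound)
    show "((\<lambda>r :: real. 2 * (1 + r\<^sup>2) / r) \<longlongrightarrow> 4) (at_left 1)"
      by (auto intro!: tendsto_eq_intros)
    have "\<forall>\<^sub>F r :: real in at_left 1. r \<in> {0<..<1}"
      by (rule eventually_at_left_real) simp
    then show "\<forall>\<^sub>F r in at_left 1. 1 / (M * (pi - \<theta>)) + 1 / (M * \<theta>) \<le> 2 * (1 + r\<^sup>2) / r"
      by eventually_elim (use bound in auto)
  qed simp
  moreover have "1 / (M * (pi - \<theta>)) + 1 / (M * \<theta>) = pi / (M * (\<theta> * (pi - \<theta>)))"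
    using M \<theta> by (simp add: field_simps)
  ultimately have "pi \<le> 4 * M * (\<theta> * (pi - \<theta>))"
    using M \<theta> by (simp add: pos_divide_le_eq mult.assoc)
  also have "\<dots> \<le> 4 * M * (pi * sin \<theta>)"
    using quadratic_le_pi_sin[of \<theta>] \<theta> M by (intro mult_left_mono) auto
  \<comment> \<open>Here \<open>M * sin \<theta> = norm w\<close>.\<close>
  also have "\<dots> = pi * (4 * norm w)"
    using w w_nz by (simp add: sin_\<theta> M_def power2_eq_square)
  finally show ?thesis
    by simp
qed

text \<open>Real \<open>w\<close> is reached by the intermediate value theorem, since the lower
  bound \<open>r / (1 + r)\<^sup>2\<close> tends to \<open>1 / 4\<close>. Otherwise conjugation
  symmetry makes \<open>f\<close> omit \<open>w\<close> and \<open>cnj w\<close> together, and the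
  estimate for omitted values applies to the one in the upper half-plane.\<close>

lemma typically_real_covers_quarter_disc:
  assumes holo: "f holomorphic_on ball 0 1" and f0: "f 0 = 0" and f'0: "deriv f 0 = 1"
    and Im_f: "\<And>z. z \<in> ball 0 1 \<Longrightarrow> 0 \<le> Im z * Im (f z)" and w: "norm w < 1 / 4"
  shows "w \<in> f ` ball 0 1"
proof (cases "Im w = 0")
  case True
  have "((\<lambda>r :: real. r / (1 + r)\<^sup>2) \<longlongrightarrow> 1 / 4) (at_left 1)"
    by (auto intro!: tendsto_eq_intros)
  then have "\<forall>\<^sub>F r :: real in at_left 1. norm w < r / (1 + r)\<^sup>2"
    using w by (rule order_tendstoD)
  moreover have "\<forall>\<^sub>F r :: real in at_left 1. r \<in> {0<..<1}"
    by (rule eventually_at_left_real) simp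
  ultimately have "\<forall>\<^sub>F r :: real in at_left 1. norm w < r / (1 + r)\<^sup>2 \<and> r \<in> {0<..<1}"
    by (rule eventually_conj)
  then obtain r :: real where r: "norm w < r / (1 + r)\<^sup>2" "0 < r" "r < 1"
    using eventually_happens' trivial_limit_at_left_real by (metis (no_types, lifting) greaterThanLessThan_iff)
  have "\<bar>Re w\<bar> \<le> norm w"
    by (rule abs_Re_le_cmod)
  then have "Re (f (of_real (- r))) \<le> Re w" "Re w \<le> Re (f (of_real r))"
    using typically_real_axis_bounds(1,2)[OF holo f0 f'0 Im_f r(2,3)] r(1) by auto
  moreover have "continuous_on {- r..r} (\<lambda>x. Re (f (of_real x)))"
    using r by (intro continuous_intros
        continuous_on_compose2[OF holomorphic_on_imp_continuous_on[OF holo]]) auto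
  ultimately obtain x where x: "- r \<le> x" "x \<le> r" "Re (f (of_real x)) = Re w"
    using IVT'[of "\<lambda>x. Re (f (of_real x))" "- r" "Re w" r] r by auto
  then have "f (of_real x) = w"
    using typically_real_on_axis[OF holo Im_f, of x] r True by (simp add: complex_eq_iff)
  then show ?thesis
    using x r by (intro image_eqI[of _ _ "of_real x"]) auto
next
  case False
  have cnj_ball: "cnj ` ball 0 1 = ball 0 1"
    by (auto simp: image_cnj_conv_vimage_cnj)
  have sym: "f z = cnj (f (cnj z))" if z: "z \<in> ball 0 1" for z
  proof -
    have "(cnj \<circ> f \<circ> cnj) holomorphic_on ball 0 1"
      by (rule holomorphic_on_compose_cnj_cnj) (use holo in \<open>auto simp: cnj_ball\<close>)
    then have holo_diff: "(\<lambda>z. f z - (cnj \<circ> f \<circ> cnj) z) holomorphic_on ball 0 1"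
      by (intro holomorphic_intros holo)
    have "f z - (cnj \<circ> f \<circ> cnj) z = 0"
    \<comment> \<open>The difference vanishes on the real interval from 0 to 1, which accumulates at
      0, so the identity theorem applies.\<close>
    proof (rule analytic_continuation[OF holo_diff, where U = "of_real ` {0<..<1}" and \<xi> = 0])
      have "(0 :: real) islimpt {0<..<1}"
        by (simp add: islimpt_greaterThanLessThan1)
      then show "(0 :: complex) islimpt of_real ` {0<..<1}"
        by (auto simp: islimpt_approachable dist_norm)
      fix u :: complex assume "u \<in> of_real ` {0<..<1}"
      then show "f u - (cnj \<circ> f \<circ> cnj) u = 0"
        using typically_real_on_axis[OF holo Im_f] by (auto simp: complex_eq_iff)
    qed (use z in auto)
    then show ?thesis
      by simp
  qed
  have cnj_omit: "cnj w \<notin> f ` ball 0 1" if "w \<notin> f ` ball 0 1"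
  proof
    assume "cnj w \<in> f ` ball 0 1"
    then obtain z where "z \<in> ball 0 1" "f z = cnj w"
      by auto
    then have "w = f (cnj z)" "cnj z \<in> ball 0 1"
      using sym[of "cnj z"] by auto
    then show False
      using that by blast
  qed
  show ?thesis
  proof (rule ccontr)
    assume omit: "w \<notin> f ` ball 0 1"
    have "1 / 4 \<le> norm w"
    proof (cases "0 < Im w")
      case True
      show ?thesis
        by (rule typically_real_omitted_nonreal[OF holo f0 f'0 Im_f True omit cnj_omit[OF omit]])
    next
      case neg: False
      then have "1 / 4 \<le> norm (cnj w)"
        by (intro typically_real_omitted_nonreal[OF holo f0 f'0 Im_f]) (use False omit cnj_omit in auto)
      then show ?thesis
        by simp
    qed
    then show False
      using w by simp
  qed
qed

section \<open>From the class \<open>typically_real\<close> to the analytic hypotheses\<close>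

lemma normalized_expansion_at_0:
  assumes "normalized_expansion f a"
  shows "f 0 = 0"
proof -
  have "(\<lambda>n. a (n + 2) * 0 ^ (n + 2)) sums (f 0 - 0)"
    using assms unfolding normalized_expansion_def by (metis centre_in_ball zero_less_one)
  then show ?thesis
    by (simp add: sums_unique2[OF sums_zero, symmetric])
qed

lemma typically_real_normalized_expansion:
  assumes f: "f \<in> typically_real" and a: "normalized_expansion f a"
  shows "f holomorphic_on ball 0 1" and "f 0 = 0" and "deriv f 0 = 1"
    and "z \<in> ball 0 1 \<Longrightarrow> 0 \<le> Im z * Im (f z)" and "norm (a (n + 2)) \<le> real (n + 2)"
proof -
  show holo: "f holomorphic_on ball 0 1"
    using f by (auto simp: typically_real_def analytic_imp_holomorphic)
  show f0: "f 0 = 0"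
    by (rule normalized_expansion_at_0[OF a])
  show Im_f: "0 \<le> Im z * Im (f z)" if "z \<in> ball 0 1" for z
  proof (cases "z \<in> \<real>")
    case True
    then show ?thesis
      by (simp add: complex_is_Real_iff)
  next
    case False
    then have "sgn (Im (f z)) = sgn (Im z)"
      using f that by (simp add: typically_real_def)
    then show ?thesis
      by (auto simp: sgn_if zero_le_mult_iff split: if_splits)
  qed
  \<comment> \<open>\<open>b\<close> lists the coefficients of \<open>f z / z\<close>, with the
    normalization supplying \<open>b 0 = 1\<close>; the bound for \<open>a (n + 2)\<close> is that
    for \<open>b (n + 1)\<close>.\<close>
  define b where "b n = (if n = 0 then 1 else a (n + 1))" for n
  define g where "g z = (if z = 0 then 1 else f z / z)" for z
  have f_g: "f z = z * g z" for z
    by (simp add: g_def f0)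
  have sums: "(\<lambda>n. b n * z ^ n) sums g z" if z: "z \<in> ball 0 1" for z
  proof (cases "z = 0")
    case True
    then show ?thesis
      using powser_sums_zero[of b] by (simp add: g_def b_def)
  next
    case False
    have "(\<lambda>n. a (n + 2) * z ^ (n + 2) / z) sums ((f z - z) / z)"
      using a z unfolding normalized_expansion_def by (intro sums_divide) blast
    then have "(\<lambda>n. b (Suc n) * z ^ Suc n) sums (g z - b 0 * z ^ 0)"
      using False by (simp add: b_def g_def diff_divide_distrib)
    from sums_Suc[where f = "\<lambda>n. b n * z ^ n", OF this] show ?thesis
      by simp
  qed
  show f'0: "deriv f 0 = 1"
  proof -
    have holo_g: "g holomorphic_on ball 0 1"
      by (rule power_series_holomorphic[where a = b]) (use sums in simp)
    have "(g has_field_derivative deriv g 0) (at 0)"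
      by (rule holomorphic_derivI[OF holo_g open_ball]) simp
    then have "((\<lambda>z. z * g z) has_field_derivative 1 * g 0 + deriv g 0 * 0) (at 0)"
      by (intro DERIV_mult DERIV_ident)
    moreover have "g 0 = 1"
      by (simp add: g_def)
    ultimately show ?thesis
      by (simp add: DERIV_imp_deriv flip: f_g)
  qed
  show "norm (a (n + 2)) \<le> real (n + 2)"
    using typically_real_coeff_bound[OF holo f'0 Im_f f_g sums, of "n + 1"] by (simp add: b_def)
qed

text \<open>The covered open disc lies in the interior of the image, so no frontier point is in it.
  An empty frontier is included, the infimum then being infinite.\<close>

lemma typically_real_dist_to_boundary:
  assumes f: "f \<in> typically_real" and a: "normalized_expansion f a"
  shows "ennreal (1 / 4) \<le> dist_to_boundary 0 (f ` ball 0 1)"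
  unfolding dist_to_boundary_def
proof (rule INF_greatest)
  fix \<xi> assume \<xi>: "\<xi> \<in> frontier (f ` ball 0 1)"
  have "ball 0 (1 / 4) \<subseteq> f ` ball 0 1"
    using typically_real_covers_quarter_disc[OF typically_real_normalized_expansion(1-4)[OF f a]]
    by auto
  then have "ball 0 (1 / 4) \<subseteq> interior (f ` ball 0 1)"
    by (simp add: interior_maximal)
  then have "\<xi> \<notin> ball 0 (1 / 4)"
    using \<xi> by (auto simp: frontier_def)
  then show "ennreal (1 / 4) \<le> ennreal (dist 0 \<xi>)"
    by (intro ennreal_leI) simp
qed

subsection \<open>The Koebe function\<close>

text \<open>The inequality amounts to \<open>r\<^sup>2 - 6 * r + 1 \<ge> 0\<close>, with roots
  \<open>3 - 2 * sqrt 2\<close> and \<open>3 + 2 * sqrt 2\<close>; the larger root exceeds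
  1.\<close>

lemma Koebe_ratio_at_radius:
  fixes r :: real
  assumes "0 \<le> r" "r < 1"
  shows "r / (1 - r)\<^sup>2 \<le> 1 / 4 \<longleftrightarrow> r \<le> 3 - 2 * sqrt 2"
proof -
  have "sqrt 2 < 2"
    using real_sqrt_less_mono[of 2 4] by simp
  then have pos: "0 < 3 + 2 * sqrt 2 - r"
    using assms by (smt (verit) real_sqrt_ge_one)
  have "r / (1 - r)\<^sup>2 \<le> 1 / 4 \<longleftrightarrow> 4 * r \<le> (1 - r)\<^sup>2"
    using assms by (simp add: divide_simps mult.commute)
  also have "\<dots> \<longleftrightarrow> 0 \<le> (3 - 2 * sqrt 2 - r) * (3 + 2 * sqrt 2 - r)"
    by (simp add: power2_eq_square algebra_simps)
  also have "\<dots> \<longleftrightarrow> r \<le> 3 - 2 * sqrt 2"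
    using pos by (auto simp: zero_le_mult_iff)
  finally show ?thesis .
qed

lemma Koebe_majorant_sums:
  fixes r :: real
  assumes "0 \<le> r" "r < 1"
  shows "(\<lambda>n. real (n + 2) * r ^ (n + 2)) sums (r / (1 - r)\<^sup>2 - r)"
proof -
  have "(\<lambda>n. r * (real (Suc n) * r ^ n)) sums (r * (1 / (1 - r)\<^sup>2))"
    by (intro sums_mult geometric_deriv_sums) (use assms in simp)
  then have "(\<lambda>n. r * (real (Suc (Suc n)) * r ^ Suc n)) sums (r * (1 / (1 - r)\<^sup>2) - r * (real (Suc 0) * r ^ 0))"
    by (subst sums_Suc_iff) simp
  then show ?thesis
    by (simp add: mult_ac)
qed

definition Koebe :: "complex \<Rightarrow> complex" where
  "Koebe z = z / (1 - z)\<^sup>2"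

lemma Koebe_normalized_expansion: "normalized_expansion Koebe of_nat"
  unfolding normalized_expansion_def
proof
  fix z :: complex assume "z \<in> ball 0 1"
  then have "(\<lambda>n. z * (of_nat (Suc n) * z ^ n)) sums (z * (1 / (1 - z)\<^sup>2))"
    by (intro sums_mult geometric_deriv_sums) simp
  then have "(\<lambda>n. z * (of_nat (Suc (Suc n)) * z ^ Suc n)) sums (z * (1 / (1 - z)\<^sup>2) - z * (of_nat (Suc 0) * z ^ 0))"
    by (subst sums_Suc_iff) simp
  then show "(\<lambda>n. of_nat (n + 2) * z ^ (n + 2)) sums (Koebe z - z)"
    by (simp add: mult_ac Koebe_def)
qed

lemma Koebe_typically_real: "Koebe \<in> typically_real"
proof -
  have "Koebe holomorphic_on ball 0 1"
    unfolding Koebe_def by (auto intro!: holomorphic_intros)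
  then have "Koebe analytic_on ball 0 1"
    by (simp add: analytic_on_open)
  moreover have "sgn (Im (Koebe z)) = sgn (Im z)" if z: "z \<in> ball 0 1" for z
  proof -
    have "(norm z)\<^sup>2 < 1"
      using z by (simp add: abs_square_less_1)
    have "1 - z \<noteq> 0"
      using z by auto
    \<comment> \<open>Making the denominator positive leaves
      \<open>z * (cnj (1 - z))\<^sup>2\<close>, whose imaginary part is
      \<open>Im z * (1 - (norm z)\<^sup>2)\<close>.\<close>
    have "of_real (norm (1 - z) ^ 4) = ((1 - z) * cnj (1 - z))\<^sup>2"
      unfolding complex_norm_square[symmetric] by (simp flip: power_mult)
    then have "Koebe z = z * (cnj (1 - z))\<^sup>2 / of_real (norm (1 - z) ^ 4)"
      using \<open>1 - z \<noteq> 0\<close> by (simp add: Koebe_def power_mult_distrib del: complex_cnj_diff)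
    then have "Im (Koebe z) = Im (z * (cnj (1 - z))\<^sup>2) / norm (1 - z) ^ 4"
      by (metis Im_divide_of_real)
    also have "Im (z * (cnj (1 - z))\<^sup>2) = Im z * (1 - (norm z)\<^sup>2)"
      unfolding cmod_power2 by (simp add: power2_eq_square algebra_simps)
    finally show ?thesis
      using \<open>1 - z \<noteq> 0\<close> \<open>(norm z)\<^sup>2 < 1\<close> by (simp add: sgn_mult sgn_divide)
  qed
  ultimately show ?thesis
    using Koebe_normalized_expansion unfolding typically_real_def by blast
qed

text \<open>The point \<open>- 1 / 4\<close> is a boundary value: the equation
  \<open>Koebe z = - 1 / 4\<close> forces \<open>z = - 1\<close>, outside the disc, while
  \<open>Koebe (- t)\<close> tends to it as \<open>t \<rightarrow> 1\<close>.\<close>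

lemma Koebe_dist_to_boundary: "dist_to_boundary 0 (Koebe ` ball 0 1) \<le> ennreal (1 / 4)"
proof -
  have "- 1 / 4 \<notin> Koebe ` ball 0 1"
  proof
    assume "- 1 / 4 \<in> Koebe ` ball 0 1"
    then obtain z :: complex where z: "z \<in> ball 0 1" and eq: "- 1 / 4 = z / (1 - z)\<^sup>2"
      unfolding Koebe_def by (rule imageE)
    have "z \<noteq> 1"
      using z by auto
    then have "z = - 1 / 4 * (1 - z)\<^sup>2"
      unfolding eq by simp
    then have "4 * z = 4 * (- 1 / 4 * (1 - z)\<^sup>2)"
      by (rule arg_cong)
    also have "\<dots> = - ((1 - z)\<^sup>2)"
      by simp
    finally have "(z + 1)\<^sup>2 = 0"
      by (simp add: power2_eq_square algebra_simps)
    then have "z = - 1"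
      by (simp add: eq_neg_iff_add_eq_0)
    then show False
      using z by simp
  qed
  moreover have "- 1 / 4 \<in> closure (Koebe ` ball 0 1)"
  proof (rule Lim_in_closed_set)
    show "((\<lambda>t :: real. Koebe (- of_real t)) \<longlongrightarrow> - 1 / 4) (at_left 1)"
      unfolding Koebe_def by (auto intro!: tendsto_eq_intros)
    have "\<forall>\<^sub>F t :: real in at_left 1. t \<in> {0<..<1}"
      by (rule eventually_at_left_real) simp
    then show "\<forall>\<^sub>F t :: real in at_left 1. Koebe (- of_real t) \<in> closure (Koebe ` ball 0 1)"
      by eventually_elim (auto intro!: closure_subset[THEN subsetD])
  qed auto
  ultimately have "- 1 / 4 \<in> frontier (Koebe ` ball 0 1)"
    using interior_subset by (auto simp: frontier_def)
  then show ?thesis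
    unfolding dist_to_boundary_def by (rule INF_lower2) simp
qed

section \<open>Comparison of majorants, the inequality and its sharpness\<close>

lemma majorant_sum_of_nat:
  assumes "norm z < 1"
  shows "majorant_sum of_nat z = ennreal (norm z / (1 - norm z)\<^sup>2)"
proof -
  have sums: "(\<lambda>n. norm (of_nat (n + 2) * z ^ (n + 2))) sums (norm z / (1 - norm z)\<^sup>2 - norm z)"
    unfolding norm_mult norm_power norm_of_nat using Koebe_majorant_sums[of "norm z"] assms by simp
  \<comment> \<open>Nonnegativity of the tail lets the two \<open>ennreal\<close> summands be added
    as reals.\<close>
  then have "0 \<le> norm z / (1 - norm z)\<^sup>2 - norm z"
    by (rule sums_le[OF _ sums_zero, rotated]) simp
  then show ?thesis
    unfolding majorant_sum_def
    by (subst suminf_ennreal_eq[OF _ sums]) (simp_all flip: ennreal_plus)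
qed

lemma majorant_sum_mono:
  assumes "\<And>n. norm (a (n + 2)) \<le> norm (b (n + 2))"
  shows "majorant_sum a z \<le> majorant_sum b z"
  unfolding majorant_sum_def norm_mult
  by (intro add_left_mono suminf_le ennreal_leI mult_right_mono assms) auto

theorem theorem5p3:
  shows "(\<forall>f\<in>typically_real. \<forall>a. normalized_expansion f a \<longrightarrow>
            (\<forall>z\<in>ball 0 1. norm z \<le> 3 - 2 * sqrt 2 \<longrightarrow>
               majorant_sum a z \<le> dist_to_boundary 0 (f ` ball 0 1)))
       \<and> (\<forall>R::real. R > 3 - 2 * sqrt 2 \<longrightarrow>
            \<not> (\<forall>f\<in>typically_real. \<forall>a. normalized_expansion f a \<longrightarrow>
                 (\<forall>z\<in>ball 0 1. norm z \<le> R \<longrightarrow>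
                    majorant_sum a z \<le> dist_to_boundary 0 (f ` ball 0 1))))"
proof (intro conjI ballI allI impI notI)
  fix f a and z :: complex
  assume f: "f \<in> typically_real" and a: "normalized_expansion f a"
    and z: "z \<in> ball 0 1" "norm z \<le> 3 - 2 * sqrt 2"
  \<comment> \<open>The coefficients \<open>of_nat\<close> of the Koebe function dominate those of
    \<open>f\<close>.\<close>
  have "majorant_sum a z \<le> majorant_sum of_nat z"
    using typically_real_normalized_expansion(5)[OF f a]
    by (intro majorant_sum_mono) (simp only: norm_of_nat)
  also have "\<dots> = ennreal (norm z / (1 - norm z)\<^sup>2)"
    using z by (intro majorant_sum_of_nat) simp
  also have "\<dots> \<le> ennreal (1 / 4)"
    using Koebe_ratio_at_radius[of "norm z"] z by (intro ennreal_leI) simp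
  also have "\<dots> \<le> dist_to_boundary 0 (f ` ball 0 1)"
    by (rule typically_real_dist_to_boundary[OF f a])
  finally show "majorant_sum a z \<le> dist_to_boundary 0 (f ` ball 0 1)" .
next
  fix R :: real
  assume R: "3 - 2 * sqrt 2 < R"
    and le: "\<forall>f\<in>typically_real. \<forall>a. normalized_expansion f a \<longrightarrow>
      (\<forall>z\<in>ball 0 1. norm z \<le> R \<longrightarrow> majorant_sum a z \<le> dist_to_boundary 0 (f ` ball 0 1))"
  \<comment> \<open>Capping at \<open>1 / 2\<close> keeps \<open>r\<close> in the disc for every
    \<open>R\<close>. The bound \<open>5 / 4 < sqrt 2\<close> puts \<open>1 / 2\<close> above the
    critical radius, and \<open>sqrt 2 \<le> 3 / 2\<close> makes that radius nonnegative.\<close>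
  define r where "r = min R (1 / 2)"
  have "sqrt 2 \<le> 3 / 2"
    by (rule real_le_lsqrt) (simp_all add: power2_eq_square)
  moreover have "5 / 4 < sqrt 2"
    by (rule real_less_rsqrt) (simp add: power2_eq_square)
  ultimately have r: "0 \<le> r" "r < 1" "3 - 2 * sqrt 2 < r" "r \<le> R"
    using R by (auto simp: r_def)
  have "ennreal (r / (1 - r)\<^sup>2) = majorant_sum of_nat (of_real r)"
    using r by (subst majorant_sum_of_nat) auto
  also have "\<dots> \<le> dist_to_boundary 0 (Koebe ` ball 0 1)"
    using le Koebe_typically_real Koebe_normalized_expansion r by auto
  also have "\<dots> \<le> ennreal (1 / 4)"
    by (rule Koebe_dist_to_boundary)
  finally have "r / (1 - r)\<^sup>2 \<le> 1 / 4"
    by simp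
  then show False
    using Koebe_ratio_at_radius[OF r(1,2)] r(3) by simp
qed

end
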